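(* Assume that $n(m) < \infty$ for every positive integer $m$. Then the set of integers $N \geq 2$ such that the Collatz polynomial $P_N$ has a root on the circle $\{z \in \mathbb{C} : |z| = 2\}$ has (natural) density $0$ in the natural numbers.
   Context: For a non-negative integer $N$ define $c(N) = N/2$ if $N$ is even, $c(N) = (3N+1)/2$ if $N$ is odd and $N \neq 1$, and $c(1) = 0$. Put $c^0(N) = N$ and $c^j(N) = c(c^{j-1}(N))$ for $j \geq 1$. Let $n(N) = \min\{ j \geq 0 : c^j(N) = 1\}$ (with $n(N)=\infty$ if there is no such $j$). Standing assumption: $n(N) < \infty$ for all positive integers $N$. The $N$th Collatz polynomial is $P_N(z) = \sum_{j=0}^{n(N)} c^j(N)\, z^j$. A set $A$ of natural numbers has density $0$ if $\lim_{x \to \infty} \frac{1}{x}\#\{N \in A : N \leq x\} = 0$. *)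

theory Defs
  imports
    "HOL-Analysis.Analysis"
    "HOL-Computational_Algebra.Polynomial"
    "HOL-Library.Extended_Nat"
begin

(* Both natural number divisions are exact. *)
definition collatz :: "nat \<Rightarrow> nat" where
  "collatz N = (if even N then N div 2 else if N = 1 then 0 else (3 * N + 1) div 2)"

(* The infimum of the empty set in enat is \<infinity>. *)
definition collatz_time :: "nat \<Rightarrow> enat" where
  "collatz_time N = Inf {enat j | j. (collatz ^^ j) N = 1}"

(* Only meaningful if collatz_time N < \<infinity>, since the_enat \<infinity> is unspecified. *)
definition collatz_poly :: "nat \<Rightarrow> complex poly" where
  "collatz_poly N = (\<Sum>j\<le>the_enat (collatz_time N). monom (of_nat ((collatz ^^ j) N)) j)"

definition density_zero :: "nat set \<Rightarrow> bool" where
  "density_zero A \<longleftrightarrow>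
     ((\<lambda>x::real. 1 / x * real (card {N \<in> A. real N \<le> x})) \<longlongrightarrow> 0) at_top"

end

theory Submission
  imports Defs
begin

text \<open>
  The circle of radius 2 is the extremal circle of the Enestroem--Kakeya theorem for Collatz
  polynomials: since \<open>c(N) \<ge> N / 2\<close> for \<open>N \<noteq> 1\<close>, the numbers \<open>b\<^sub>j = 2\<^sup>j c\<^sup>j(N)\<close> are
  nondecreasing for \<open>j \<le> n = n(N)\<close>, and
  a root \<open>z = 2 w\<close> with \<open>\<bar>w\<bar> = 1\<close> satisfies \<open>\<Sum> b\<^sub>j w\<^sup>j = 0\<close>.  Multiplying by \<open>1 - w\<close> writes
  \<open>b\<^sub>n w\<^sup>n\<^sup>+\<^sup>1\<close> as a combination of powers of \<open>w\<close> whose nonnegative coefficients sum to \<open>b\<^sub>n\<close>, so the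
  triangle inequality is an equality and all powers that occur coincide
  (\<open>enestroem_kakeya_boundary_root\<close>).  The power \<open>w\<^sup>0\<close> occurs, so \<open>w\<^sup>n\<^sup>+\<^sup>1 = 1\<close>; and \<open>w\<^sup>j\<^sup>+\<^sup>1\<close> occurs
  for every \<open>j < n\<close> with \<open>c\<^sup>j(N)\<close> odd, since then the step from \<open>c\<^sup>j(N)\<close> is not a mere halving.  Two
  consecutive odd iterates would give \<open>w = 1\<close>, which is impossible because the coefficients
  are positive.

  A number above 1 and its successor in the orbit are both odd exactly when the number is 3
  modulo 4.  So the orbit of \<open>N\<close> never meets the class of 3 modulo 4
  (\<open>collatz_orbit_avoids_3_mod_4\<close>).  On the other classes two Collatz steps map \<open>4 y + r\<close> to
  \<open>y\<close>, \<open>3 y + 1\<close> or \<open>3 y + 2\<close>, apart from harmless exceptions at 1 and 2.  These slopes are odd,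
  so the images are again equidistributed modulo 4.  Hence, looking at every second iterate, each
  of the first \<open>m\<close> inspections discards one of four classes, and at most \<open>3\<^sup>m\<close> of any \<open>4\<^sup>m\<close>
  consecutive integers survive (\<open>card_even_iterates_avoid_3_le\<close>).  As \<open>(3/4)\<^sup>m\<close> tends to 0, the
  density is 0.
\<close>

section \<open>Roots on the extremal circle of the Enestroem--Kakeya theorem\<close>

text \<open>
  The case of equality in the triangle inequality: the real parts of the rotated summands
  \<open>u i * cnj v\<close> are at most 1 and their weighted mean is 1.
\<close>
lemma unit_combination_extremal:
  fixes d :: "'i \<Rightarrow> real" and u :: "'i \<Rightarrow> complex"
  assumes fin: "finite I" and d: "\<And>i. i \<in> I \<Longrightarrow> d i \<ge> 0"
    and u: "\<And>i. i \<in> I \<Longrightarrow> cmod (u i) = 1" and v: "cmod v = 1"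
    and eq: "(\<Sum>i\<in>I. of_real (d i) * u i) = of_real (\<Sum>i\<in>I. d i) * v"
    and i: "i \<in> I" "d i > 0"
  shows "u i = v"
proof -
  have vv: "v * cnj v = 1"
    using v by (simp flip: complex_norm_square)
  have unit: "cmod (u j * cnj v) = 1" if "j \<in> I" for j
    using u[OF that] v by (simp add: norm_mult)
  have "(\<Sum>j\<in>I. of_real (d j) * (u j * cnj v)) = of_real (\<Sum>j\<in>I. d j) * (v * cnj v)"
    using arg_cong[OF eq, of "\<lambda>x. x * cnj v"] by (simp only: sum_distrib_right mult.assoc)
  then have "(\<Sum>j\<in>I. of_real (d j) * (u j * cnj v)) = of_real (\<Sum>j\<in>I. d j)"
    by (simp only: vv mult_1_right)
  then have "Re (\<Sum>j\<in>I. of_real (d j) * (u j * cnj v)) = (\<Sum>j\<in>I. d j)"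
    by (metis Re_complex_of_real)
  then have "(\<Sum>j\<in>I. d j * Re (u j * cnj v)) = (\<Sum>j\<in>I. d j)"
    by simp
  then have "(\<Sum>j\<in>I. d j * (1 - Re (u j * cnj v))) = 0"
    by (simp only: right_diff_distrib sum_subtractf mult_1_right diff_self)
  moreover have "d j * (1 - Re (u j * cnj v)) \<ge> 0" if "j \<in> I" for j
    using d[OF that] complex_Re_le_cmod[of "u j * cnj v"] unit[OF that]
    by (intro mult_nonneg_nonneg) linarith+
  ultimately have "d i * (1 - Re (u i * cnj v)) = 0"
    using fin i(1) sum_nonneg_eq_0_iff[of I "\<lambda>j. d j * (1 - Re (u j * cnj v))"] by blast
  then have re: "Re (u i * cnj v) = 1"
    using i(2) by (metis less_irrefl mult_eq_0_iff eq_iff_diff_eq_0)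
  have "(Re (u i * cnj v))\<^sup>2 + (Im (u i * cnj v))\<^sup>2 = 1"
    using unit[OF i(1)] by (metis cmod_power2 one_power2)
  then have "Im (u i * cnj v) = 0"
    unfolding re by simp
  with re have "u i * cnj v = 1"
    by (metis complex_eqI one_complex.sel)
  then have "u i * (v * cnj v) = v"
    by (metis mult.assoc mult.commute mult_1_left)
  then show ?thesis
    by (simp add: vv)
qed

text \<open>
  Multiplying \<open>\<Sum> b\<^sub>j w\<^sup>j\<close> by \<open>1 - w\<close> leaves the increments of \<open>b\<close> as coefficients, and these are
  nonnegative and telescope to \<open>b\<^sub>n\<close>.
\<close>
lemma enestroem_kakeya_boundary_root:
  fixes b :: "nat \<Rightarrow> real"
  assumes mono: "\<And>j. j < n \<Longrightarrow> b j \<le> b (Suc j)" and pos: "b 0 > 0"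
    and w: "cmod w = 1" and root: "(\<Sum>j\<le>n. of_real (b j) * w ^ j) = 0"
  shows "w ^ Suc n = 1" and "\<And>j. j < n \<Longrightarrow> b j < b (Suc j) \<Longrightarrow> w ^ Suc j = 1"
proof -
  define d where "d j = (case j of 0 \<Rightarrow> b 0 | Suc i \<Rightarrow> b (Suc i) - b i)" for j
  have d_sum: "(\<Sum>j\<le>k. d j) = b k" for k
    by (induction k) (auto simp: d_def)
  have "(\<Sum>j\<le>k. of_real (d j) * w ^ j)
      = (1 - w) * (\<Sum>j\<le>k. of_real (b j) * w ^ j) + of_real (b k) * w ^ Suc k" for k
    by (induction k) (auto simp: d_def algebra_simps)
  then have comb: "(\<Sum>j\<le>n. of_real (d j) * w ^ j) = of_real (\<Sum>j\<le>n. d j) * w ^ Suc n"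
    unfolding d_sum by (simp add: root)
  have d_nonneg: "d j \<ge> 0" if "j \<le> n" for j
    using that mono[of "j - 1"] pos by (cases j) (auto simp: d_def)
  have same: "w ^ j = w ^ Suc n" if "j \<le> n" "d j > 0" for j
    by (rule unit_combination_extremal[of "{..n}" d "\<lambda>j. w ^ j"])
       (use that d_nonneg comb w in \<open>auto simp: norm_power norm_mult\<close>)
  show one: "w ^ Suc n = 1"
    using same[of 0] pos by (simp add: d_def)
  show "w ^ Suc j = 1" if "j < n" "b j < b (Suc j)" for j
    using same[of "Suc j"] that unfolding one by (simp add: d_def)
qed

section \<open>Orbits whose polynomial has a root of modulus 2\<close>

lemma collatz_time_finiteE:
  assumes "collatz_time N < \<infinity>"
  obtains n where "collatz_time N = enat n" "(collatz ^^ n) N = 1"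
    "\<And>j. j < n \<Longrightarrow> (collatz ^^ j) N \<noteq> 1"
proof -
  let ?S = "{enat j | j. (collatz ^^ j) N = 1}"
  obtain n where n: "collatz_time N = enat n"
    using assms by (cases "collatz_time N") auto
  have "?S \<noteq> {}"
    using assms unfolding collatz_time_def by (metis Inf_empty less_irrefl top_enat_def)
  then have "Inf ?S \<in> ?S"
    by (meson ex_in_conv wellorder_InfI)
  then have "(collatz ^^ n) N = 1"
    using n by (auto simp: collatz_time_def)
  moreover have "(collatz ^^ j) N \<noteq> 1" if "j < n" for j
  proof
    assume "(collatz ^^ j) N = 1"
    then have "Inf ?S \<le> enat j"
      by (intro Inf_lower) auto
    then show False
      using n that by (simp add: collatz_time_def)
  qed
  ultimately show ?thesis
    using n that by blast
qed

lemma collatz_funpow_le_2: "N \<le> 2 \<Longrightarrow> (collatz ^^ j) N \<le> 2"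
proof (induction j)
  case (Suc j)
  then have "(collatz ^^ j) N \<in> {0, 1, 2}"
    by auto
  then have "collatz ((collatz ^^ j) N) \<le> 2"
    by (elim insertE emptyE) (simp_all add: collatz_def)
  then show ?case
    by simp
qed simp

text \<open>
  An orbit that meets 3 modulo 4 contains two consecutive odd numbers, at positions \<open>j\<close> and
  \<open>j + 1\<close> say.  Both force the root \<open>w\<close> of unity to satisfy \<open>w\<^sup>j\<^sup>+\<^sup>1 = w\<^sup>j\<^sup>+\<^sup>2 = 1\<close>, hence \<open>w = 1\<close>.
\<close>
lemma collatz_orbit_avoids_3_mod_4:
  assumes N: "N > 0" and fin: "collatz_time N < \<infinity>"
    and z: "cmod z = 2" and root: "poly (collatz_poly N) z = 0"
  shows "(collatz ^^ k) N mod 4 \<noteq> 3"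
proof
  assume k3: "(collatz ^^ k) N mod 4 = 3"
  define a where "a j = (collatz ^^ j) N" for j
  obtain n where n: "collatz_time N = enat n" "a n = 1" "\<And>j. j < n \<Longrightarrow> a j \<noteq> 1"
    using collatz_time_finiteE[OF fin] unfolding a_def by metis
  have a_Suc: "a (Suc j) = collatz (a j)" for j
    by (simp add: a_def)
  have step: "2 * a (Suc j) = (if odd (a j) then 3 * a j + 1 else a j)" if "j < n" for j
    using n(3)[OF that] by (simp add: a_Suc collatz_def)
  define b where "b j = real (a j) * 2 ^ j" for j
  define w where "w = z / 2"
  have bstep: "b (Suc j) = real (2 * a (Suc j)) * 2 ^ j" for j
    by (simp add: b_def)
  have b0: "b 0 > 0"
    using N by (simp add: b_def a_def)
  have mono: "b j \<le> b (Suc j)" if "j < n" for j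
    unfolding bstep step[OF that] by (simp add: b_def)
  have incr: "b j < b (Suc j)" if "j < n" "odd (a j)" for j
    unfolding bstep step[OF that(1)] using that(2) by (simp add: b_def)
  have w: "cmod w = 1"
    using z by (simp add: w_def norm_divide)
  have "poly (collatz_poly N) z = (\<Sum>j\<le>n. of_nat (a j) * z ^ j)"
    by (simp add: collatz_poly_def n(1) poly_sum poly_monom a_def)
  also have "\<dots> = (\<Sum>j\<le>n. of_real (b j) * w ^ j)"
    by (intro sum.cong refl) (simp add: b_def w_def power_divide)
  finally have sum0: "(\<Sum>j\<le>n. of_real (b j) * w ^ j) = 0"
    using root by simp
  note unity = enestroem_kakeya_boundary_root[OF mono b0 w sum0]
  \<comment> \<open>From position \<open>n\<close> on the orbit is 1, 0, 0, ..., so the hit lies before \<open>n\<close>.\<close>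
  have "k < n"
  proof (rule ccontr)
    assume "\<not> k < n"
    then have "a k = (collatz ^^ (k - n)) (a n)"
      unfolding a_def by (metis funpow_add o_apply le_add_diff_inverse2 not_less)
    then have "a k \<le> 2"
      using collatz_funpow_le_2[of 1] n(2) by simp
    then show False
      using k3 by (simp add: a_def)
  qed
  have odds: "odd (a k)" "odd (a (Suc k))"
  proof -
    have "a k mod 4 = 3"
      using k3 by (simp add: a_def)
    then show "odd (a k)"
      by presburger
    then have "2 * a (Suc k) = 3 * a k + 1"
      using step[OF \<open>k < n\<close>] by simp
    with \<open>a k mod 4 = 3\<close> show "odd (a (Suc k))"
      by presburger
  qed
  have w1: "w ^ Suc k = 1"
    using unity(2)[of k] incr[of k] \<open>k < n\<close> odds by blast
  \<comment> \<open>If the second odd number is the final 1, the exponent \<open>n + 1\<close> takes over its role.\<close>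
  have "w ^ Suc (Suc k) = 1"
  proof (cases "Suc k = n")
    case True
    then show ?thesis using unity(1) by simp
  next
    case False
    then show ?thesis using unity(2)[of "Suc k"] incr[of "Suc k"] \<open>k < n\<close> odds by simp
  qed
  with w1 have "w = 1"
    by simp
  with sum0 have "(\<Sum>j\<le>n. b j) = 0"
    by (simp flip: of_real_sum)
  moreover have "(\<Sum>j\<le>n. b j) \<ge> b 0"
    by (rule member_le_sum) (auto simp: b_def)
  ultimately show False
    using b0 by simp
qed

section \<open>Counting orbits that avoid 3 modulo 4\<close>

text \<open>
  Only every second iterate is inspected: the residue of a number modulo 4 governs the next two
  steps, so the successive inspections are independent.
\<close>
primrec even_iterates_avoid_3 :: "nat \<Rightarrow> nat \<Rightarrow> bool" where
  "even_iterates_avoid_3 0 N \<longleftrightarrow> True"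
| "even_iterates_avoid_3 (Suc m) N \<longleftrightarrow>
     N mod 4 \<noteq> 3 \<and> even_iterates_avoid_3 m (collatz (collatz N))"

lemma even_iterates_avoid_3I:
  assumes "\<And>j. (collatz ^^ j) N mod 4 \<noteq> 3"
  shows "even_iterates_avoid_3 m N"
  using assms
proof (induction m arbitrary: N)
  case (Suc m)
  have "(collatz ^^ j) (collatz (collatz N)) mod 4 \<noteq> 3" for j
    using Suc.prems[of "Suc (Suc j)"] by (simp only: funpow_Suc_right o_apply not_False_eq_True)
  then show ?case
    using Suc.IH Suc.prems[of 0] by simp
qed simp

lemma even_iterates_avoid_3_le_2:
  assumes "N \<le> 2"
  shows "even_iterates_avoid_3 m N"
proof (rule even_iterates_avoid_3I)
  show "(collatz ^^ j) N mod 4 \<noteq> 3" for j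
    using collatz_funpow_le_2[OF assms, of j] by auto
qed

text \<open>
  The map \<open>c\<close> is exceptional at 1, so for \<open>y = 0\<close> two steps from 1 or 2 do not follow the affine
  formulas.  The equivalences survive because no orbit from 0, 1 or 2 leads to 3 modulo 4.
\<close>
lemma even_iterates_avoid_3_Suc_residues:
  "even_iterates_avoid_3 (Suc m) (4 * y) \<longleftrightarrow> even_iterates_avoid_3 m y"
  "even_iterates_avoid_3 (Suc m) (4 * y + 1) \<longleftrightarrow> even_iterates_avoid_3 m (3 * y + 1)"
  "even_iterates_avoid_3 (Suc m) (4 * y + 2) \<longleftrightarrow> even_iterates_avoid_3 m (3 * y + 2)"
  "\<not> even_iterates_avoid_3 (Suc m) (4 * y + 3)"
proof -
  have "collatz (4 * y) = 2 * y" "collatz (2 * y) = y"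
    by (simp_all add: collatz_def)
  then show "even_iterates_avoid_3 (Suc m) (4 * y) \<longleftrightarrow> even_iterates_avoid_3 m y"
    by simp
  show "even_iterates_avoid_3 (Suc m) (4 * y + 1) \<longleftrightarrow> even_iterates_avoid_3 m (3 * y + 1)"
  proof (cases "y = 0")
    case True
    then show ?thesis
      using even_iterates_avoid_3_le_2[of 1] by (simp del: even_iterates_avoid_3.simps)
  next
    case False
    then have "collatz (4 * y + 1) = 6 * y + 2" "collatz (6 * y + 2) = 3 * y + 1"
      by (simp_all add: collatz_def)
    moreover have "(4 * y + 1) mod 4 \<noteq> 3"
      by presburger
    ultimately show ?thesis
      by (simp only: even_iterates_avoid_3.simps simp_thms)
  qed
  show "even_iterates_avoid_3 (Suc m) (4 * y + 2) \<longleftrightarrow> even_iterates_avoid_3 m (3 * y + 2)"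
  proof (cases "y = 0")
    case True
    have "even_iterates_avoid_3 k 2" for k
      by (rule even_iterates_avoid_3_le_2) simp
    with True show ?thesis
      by (metis add_0 mult_0_right)
  next
    case False
    then have "collatz (4 * y + 2) = 2 * y + 1" "collatz (2 * y + 1) = 3 * y + 2"
      by (simp_all add: collatz_def)
    moreover have "(4 * y + 2) mod 4 \<noteq> 3"
      by presburger
    ultimately show ?thesis
      by (simp only: even_iterates_avoid_3.simps simp_thms)
  qed
  show "\<not> even_iterates_avoid_3 (Suc m) (4 * y + 3)"
    by simp
qed

lemma odd_affine_hits_3_mod_4:
  fixes q b :: nat
  assumes "odd q"
  obtains r where "r < 4" "(q * r + b) mod 4 = 3"
proof -
  define p where "p = q mod 4"
  define \<beta> where "\<beta> = b mod 4"
  have p: "p = 1 \<or> p = 3"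
    unfolding p_def using assms by presburger
  have \<beta>: "\<beta> = 0 \<or> \<beta> = 1 \<or> \<beta> = 2 \<or> \<beta> = 3"
    unfolding \<beta>_def by linarith
  have reduce: "(q * r + b) mod 4 = (p * r + \<beta>) mod 4" for r
  proof -
    have "(p * r + \<beta>) mod 4 = ((p * r) mod 4 + \<beta>) mod 4"
      by (simp only: mod_add_left_eq)
    then show ?thesis
      unfolding p_def \<beta>_def by (simp only: mod_mult_left_eq mod_add_eq)
  qed
  \<comment> \<open>An odd \<open>p\<close> is its own inverse modulo 4, which gives the solution \<open>p (3 - \<beta>)\<close>.\<close>
  have "(p * (p * (3 - \<beta>) mod 4) + \<beta>) mod 4 = 3"
    using p \<beta> by (elim disjE) simp_all
  then show ?thesis
    using that[of "p * (3 - \<beta>) mod 4"] reduce by simp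
qed

text \<open>
  The induction needs arithmetic progressions with an arbitrary odd difference \<open>q\<close>, because two
  steps turn a progression into one whose difference has been multiplied by 1 or 3.  Oddness makes
  the four subprogressions \<open>t = 4 s + r\<close> run through the four classes modulo 4, and the one in the
  class of 3 contributes nothing.
\<close>
lemma card_even_iterates_avoid_3_le:
  assumes "odd q"
  shows "card {t. t < 4 ^ m \<and> even_iterates_avoid_3 m (q * t + b)} \<le> 3 ^ m"
  using assms
proof (induction m arbitrary: q b)
  case 0
  then show ?case by simp
next
  case (Suc m)
  define C where
    "C r = {s. s < 4 ^ m \<and> even_iterates_avoid_3 (Suc m) (q * (4 * s + r) + b)}" for r
  have split: "q * (4 * s + r) + b = 4 * (q * s + (q * r + b) div 4) + (q * r + b) mod 4" for s r
  proof -
    have "q * (4 * s + r) + b = 4 * (q * s) + (q * r + b)"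
      by (simp add: algebra_simps)
    also have "\<dots> = 4 * (q * s) + (4 * ((q * r + b) div 4) + (q * r + b) mod 4)"
      by simp
    finally show ?thesis by (simp only: distrib_left add.assoc)
  qed
  have C_le: "card (C r) \<le> 3 ^ m" for r
  proof -
    let ?u = "(q * r + b) div 4"
    have C_le_if: ?thesis if "odd k"
      "\<And>y. even_iterates_avoid_3 (Suc m) (4 * y + (q * r + b) mod 4)
        \<longleftrightarrow> even_iterates_avoid_3 m (k * y + l)" for k l
    proof -
      have "C r = {s. s < 4 ^ m \<and> even_iterates_avoid_3 m (k * q * s + (k * ?u + l))}"
        unfolding C_def split that(2) by (simp only: distrib_left mult.assoc add.assoc)
      then show ?thesis
        using Suc.IH[of "k * q" "k * ?u + l"] Suc.prems that(1) by simp
    qed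
    consider "(q * r + b) mod 4 = 0" | "(q * r + b) mod 4 = 1"
      | "(q * r + b) mod 4 = 2" | "(q * r + b) mod 4 = 3"
      by linarith
    then show ?thesis
    proof cases
      case 1
      show ?thesis
        by (rule C_le_if[of 1 0]) (simp_all only: 1 odd_one not_False_eq_True add_0_right mult_1_left
            even_iterates_avoid_3_Suc_residues)
    next
      case 2
      show ?thesis
        by (rule C_le_if[of 3 1]) (simp_all only: 2 odd_numeral not_False_eq_True
            even_iterates_avoid_3_Suc_residues)
    next
      case 3
      show ?thesis
        by (rule C_le_if[of 3 2]) (simp_all only: 3 odd_numeral not_False_eq_True
            even_iterates_avoid_3_Suc_residues)
    next
      case 4
      have "C r = {}"
        unfolding C_def split 4 using even_iterates_avoid_3_Suc_residues(4) by blast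
      then show ?thesis by simp
    qed
  qed
  obtain r0 where r0: "r0 < 4" "(q * r0 + b) mod 4 = 3"
    using odd_affine_hits_3_mod_4[OF Suc.prems] by blast
  have C_r0: "C r0 = {}"
    unfolding C_def split r0(2) using even_iterates_avoid_3_Suc_residues(4) by blast
  have "{t. t < 4 ^ Suc m \<and> even_iterates_avoid_3 (Suc m) (q * t + b)}
      \<subseteq> (\<Union>r\<in>{..<4} - {r0}. (\<lambda>s. 4 * s + r) ` C r)"
  proof
    fix t assume t: "t \<in> {t. t < 4 ^ Suc m \<and> even_iterates_avoid_3 (Suc m) (q * t + b)}"
    have "t div 4 < 4 ^ m"
      using t by (simp add: less_mult_imp_div_less mult.commute)
    moreover have "even_iterates_avoid_3 (Suc m) (q * (4 * (t div 4) + t mod 4) + b)"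
      using t by (simp only: mult_div_mod_eq mem_Collect_eq)
    ultimately have "t div 4 \<in> C (t mod 4)"
      unfolding C_def by blast
    moreover from this have "t mod 4 \<noteq> r0"
      using C_r0 by auto
    ultimately show "t \<in> (\<Union>r\<in>{..<4} - {r0}. (\<lambda>s. 4 * s + r) ` C r)"
      by (intro UN_I[of "t mod 4"] image_eqI[of _ _ "t div 4"]) simp_all
  qed
  moreover have fin: "finite (C r)" for r
    unfolding C_def by simp
  ultimately have "card {t. t < 4 ^ Suc m \<and> even_iterates_avoid_3 (Suc m) (q * t + b)}
      \<le> card (\<Union>r\<in>{..<4} - {r0}. (\<lambda>s. 4 * s + r) ` C r)"
    by (intro card_mono) auto
  also have "\<dots> \<le> (\<Sum>r\<in>{..<4} - {r0}. card ((\<lambda>s. 4 * s + r) ` C r))"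
    by (rule card_UN_le) simp
  also have "\<dots> \<le> (\<Sum>r\<in>{..<4} - {r0}. 3 ^ m)"
    by (intro sum_mono order.trans[OF card_image_le[OF fin] C_le])
  also have "\<dots> = 3 ^ Suc m"
    using r0(1) by simp
  finally show ?case .
qed

section \<open>Density\<close>

text \<open>
  Uniform (Banach) density 0 implies density 0: an initial segment is covered by windows of the
  length \<open>L\<close> belonging to \<open>\<epsilon>\<close>, with an overshoot of at most one window.
\<close>
lemma density_zero_if_sparse_windows:
  assumes "\<And>\<epsilon>. \<epsilon> > 0 \<Longrightarrow> \<exists>L>0. \<forall>b. real (card {t. t < L \<and> t + b \<in> A}) \<le> \<epsilon> * real L"
  shows "density_zero A"
  unfolding density_zero_def
proof (rule tendstoI)
  fix e :: real assume "e > 0"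
  then obtain L where L: "L > 0"
    and window: "\<And>b. real (card {t. t < L \<and> t + b \<in> A}) \<le> e / 3 * real L"
    using assms[of "e / 3"] by auto
  have initial: "real (card {N \<in> A. N < K * L}) \<le> real K * (e / 3 * real L)" for K
  proof (induction K)
    case (Suc K)
    have "{N \<in> A. N < Suc K * L}
        \<subseteq> {N \<in> A. N < K * L} \<union> (\<lambda>t. t + K * L) ` {t. t < L \<and> t + K * L \<in> A}"
    proof
      fix N assume N: "N \<in> {N \<in> A. N < Suc K * L}"
      show "N \<in> {N \<in> A. N < K * L} \<union> (\<lambda>t. t + K * L) ` {t. t < L \<and> t + K * L \<in> A}"
      proof (cases "N < K * L")
        case False
        then have "N = (N - K * L) + K * L" "N - K * L < L"
          using N by auto
        then show ?thesis using N by (intro UnI2 image_eqI[of _ _ "N - K * L"]) auto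
      qed (use N in auto)
    qed
    then have "card {N \<in> A. N < Suc K * L}
        \<le> card ({N \<in> A. N < K * L} \<union> (\<lambda>t. t + K * L) ` {t. t < L \<and> t + K * L \<in> A})"
      by (intro card_mono) auto
    also have "\<dots> \<le> card {N \<in> A. N < K * L} + card {t. t < L \<and> t + K * L \<in> A}"
      by (intro order.trans[OF card_Un_le] add_mono card_image_le) auto
    finally have "real (card {N \<in> A. N < Suc K * L})
        \<le> real (card {N \<in> A. N < K * L}) + real (card {t. t < L \<and> t + K * L \<in> A})"
      by linarith
    also have "\<dots> \<le> real K * (e / 3 * real L) + e / 3 * real L"
      by (intro add_mono Suc.IH window)
    finally show ?case by (simp add: algebra_simps)
  qed simp
  have "dist (1 / x * real (card {N \<in> A. real N \<le> x})) 0 < e" if x: "x \<ge> real L" for x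
  proof -
    have x0: "x > 0"
      using x L by linarith
    define K where "K = Suc (nat \<lfloor>x / real L\<rfloor>)"
    have "real K = of_int \<lfloor>x / real L\<rfloor> + 1"
      using x0 by (simp add: K_def)
    then have K: "x / real L < real K" "real K \<le> x / real L + 1"
      by linarith+
    have "x < real (K * L)"
      using K(1) L by (simp add: divide_less_eq)
    then have "N < K * L" if "real N \<le> x" for N
      using that by (metis of_nat_less_iff order.strict_trans1)
    then have "{N \<in> A. real N \<le> x} \<subseteq> {N \<in> A. N < K * L}"
      by blast
    then have "real (card {N \<in> A. real N \<le> x}) \<le> real (card {N \<in> A. N < K * L})"
      by (intro of_nat_mono card_mono) auto
    also have "\<dots> \<le> real K * (e / 3 * real L)"
      by (rule initial)
    also have "\<dots> \<le> (x / real L + 1) * (e / 3 * real L)"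
      using K(2) \<open>e > 0\<close> by (intro mult_right_mono) auto
    also have "\<dots> = e / 3 * (x + real L)"
      using L by (simp add: field_simps)
    also have "\<dots> \<le> e / 3 * (2 * x)"
      using x \<open>e > 0\<close> by (intro mult_left_mono) auto
    also have "\<dots> < e * x"
      using \<open>e > 0\<close> x0 by simp
    finally show ?thesis
      using x0 by (simp add: dist_real_def field_simps)
  qed
  then show "\<forall>\<^sub>F x in at_top. dist (1 / x * real (card {N \<in> A. real N \<le> x})) 0 < e"
    using eventually_at_top_linorder by blast
qed

theorem theorem4:
  assumes "\<And>m::nat. m > 0 \<Longrightarrow> collatz_time m < \<infinity>"
  shows "density_zero {N. N \<ge> 2 \<and> (\<exists>z::complex. cmod z = 2 \<and> poly (collatz_poly N) z = 0)}"
    (is "density_zero ?A")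
proof (rule density_zero_if_sparse_windows)
  fix \<epsilon> :: real assume "\<epsilon> > 0"
  then obtain m where m: "(3 / 4 :: real) ^ m < \<epsilon>"
    using real_arch_pow_inv[of \<epsilon> "3 / 4"] by auto
  have avoid: "even_iterates_avoid_3 m N" if "N \<in> ?A" for N
  proof -
    from that obtain z where "N > 0" "cmod z = 2" "poly (collatz_poly N) z = 0"
      by auto
    then show ?thesis
      by (intro even_iterates_avoid_3I collatz_orbit_avoids_3_mod_4 assms)
  qed
  have "real (card {t. t < 4 ^ m \<and> t + b \<in> ?A}) \<le> \<epsilon> * real (4 ^ m)" for b
  proof -
    have "card {t. t < 4 ^ m \<and> t + b \<in> ?A}
        \<le> card {t. t < 4 ^ m \<and> even_iterates_avoid_3 m (1 * t + b)}"
      by (intro card_mono) (use avoid in auto)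
    also have "\<dots> \<le> 3 ^ m"
      by (rule card_even_iterates_avoid_3_le) simp
    finally have "real (card {t. t < 4 ^ m \<and> t + b \<in> ?A}) \<le> real (3 ^ m)"
      by (rule of_nat_mono)
    also have "\<dots> = (3 / 4) ^ m * real (4 ^ m)"
      by (simp add: power_divide)
    also have "\<dots> \<le> \<epsilon> * real (4 ^ m)"
      using m by (intro mult_right_mono) auto
    finally show ?thesis .
  qed
  then show "\<exists>L>0. \<forall>b. real (card {t. t < L \<and> t + b \<in> ?A}) \<le> \<epsilon> * real L"
    by (intro exI[of _ "4 ^ m"]) simp
qed

end
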